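(* There exists an absolute constant $c>0$ such that for infinitely many positive integers $n$ the following holds: for every real $p$ with $1\le p\le n^{4/3}$ there exists an $n$-vertex directed unweighted graph $G=(V,E)$ such that for every shortcut set $H$ of $G$ with $|H|\le p$, the graph $G\cup H$ has diameter at least $c\,\frac{n}{p^{3/4}}$.
   Context: For a directed graph $G=(V,E)$, a shortcut set is a set $H$ of ordered pairs $(u,v)$ of distinct vertices such that $v$ is reachable from $u$ in $G$. $G\cup H$ denotes $(V,E\cup H)$. The diameter of a directed graph is $\max \mathrm{dist}(u,v)$ over all ordered pairs $(u,v)$ with $v$ reachable from $u$, with $\mathrm{dist}$ the unweighted shortest-path distance. *)

theory Defs
  imports Complex_Main "Graph_Theory.Pair_Digraph" "Graph_Theory.Shortest_Path"
begin

definition shortcut_set :: "'a pair_pre_digraph \<Rightarrow> ('a \<times> 'a) set \<Rightarrow> bool" where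
  "shortcut_set G H \<longleftrightarrow> (\<forall>(u, v) \<in> H. u \<noteq> v \<and> u \<rightarrow>\<^sup>*\<^bsub>with_proj G\<^esub> v)"

definition add_shortcuts :: "'a pair_pre_digraph \<Rightarrow> ('a \<times> 'a) set \<Rightarrow> 'a pair_pre_digraph" where
  "add_shortcuts G H = \<lparr>pverts = pverts G, parcs = parcs G \<union> H\<rparr>"

text \<open>
  Every arc has weight 1, so the cost of a walk is its number of arcs; the value is infinite
  if there is no walk.
\<close>
definition unweighted_dist :: "'a pair_pre_digraph \<Rightarrow> 'a \<Rightarrow> 'a \<Rightarrow> ereal" where
  "unweighted_dist G u v = wf_digraph.\<mu> (with_proj G) (\<lambda>_. 1) u v"

text \<open>
  Reachability includes \<^term>\<open>u = v\<close> for vertices of the graph, so for a finite graph with at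
  least one vertex the maximum is over a finite nonempty set; unreachable pairs are ignored.
\<close>
definition diameter :: "'a pair_pre_digraph \<Rightarrow> ereal" where
  "diameter G = Max {unweighted_dist G u v | u v. u \<rightarrow>\<^sup>*\<^bsub>with_proj G\<^esub> v}"

lemma (in pair_wf_digraph) unweighted_dist_conv:
  "unweighted_dist G u v = (INF p \<in> {p. awalk u p v}. ereal (real (length p)))"
  by (simp add: unweighted_dist_def \<mu>_def awalk_cost_def sum_list_triv)

lemma (in pair_digraph) pair_digraph_add_shortcuts:
  assumes "shortcut_set G H"
  shows "pair_digraph (add_shortcuts G H)" and "finite H"
proof -
  have sub: "H \<subseteq> pverts G \<times> pverts G"
  proof
    fix e assume "e \<in> H"
    then have "fst e \<rightarrow>\<^sup>*\<^bsub>with_proj G\<^esub> snd e"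
      using assms by (auto simp: shortcut_set_def)
    then have "fst e \<in> verts (with_proj G) \<and> snd e \<in> verts (with_proj G)"
      by (elim reachable_in_vertsE) simp
    then show "e \<in> pverts G \<times> pverts G"
      by (simp add: mem_Times_iff)
  qed
  then show fin: "finite H"
    by (rule finite_subset) simp
  have distinct: "fst e \<noteq> snd e" if "e \<in> H" for e
    using assms that by (auto simp: shortcut_set_def)
  show "pair_digraph (add_shortcuts G H)"
  proof
    fix e assume "e \<in> parcs (add_shortcuts G H)"
    then have e: "e \<in> parcs G \<or> e \<in> H" by (simp add: add_shortcuts_def)
    have "fst e \<in> pverts G"
      using e sub arc_fst_in_verts[of e] by (metis mem_Times_iff subsetD)
    then show "fst e \<in> pverts (add_shortcuts G H)" by (simp add: add_shortcuts_def)
    have "snd e \<in> pverts G"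
      using e sub arc_snd_in_verts[of e] by (metis mem_Times_iff subsetD)
    then show "snd e \<in> pverts (add_shortcuts G H)" by (simp add: add_shortcuts_def)
    show "fst e \<noteq> snd e" using e distinct pair_no_loops by blast
  qed (simp_all add: add_shortcuts_def fin)
qed

end

theory Submission
  imports Defs "HOL-Library.Nat_Bijection"
begin

text \<open>
  The graph is layered; a vertex is a layer together with a point of a two-dimensional grid.
  Each threshold \<open>a\<close> is assigned to one layer, and the walk with direction \<open>x\<close> moves by
  \<open>(1, a)\<close> for every threshold \<open>a \<le> x\<close> of the layer that it leaves. Among all moves available
  in a layer, this one is the unique maximiser of the functional \<open>(2x + 1) y - 2z\<close>, so each such
  walk is the only walk between its ends, even up to shortcuts. A shortcut therefore helps a
  direction only if both its ends lie on that walk, and directions \<open>x < x'\<close> can share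
  both ends only if no threshold in \<open>{x<..x'}\<close> is assigned to a layer between them.
  With thresholds distributed over the layers by bit reversal (the van der Corput sequence),
  a shortcut that skips \<open>d\<close> of the \<open>2^m\<close> layers helps at most \<open>4 * 2^m / d\<close> directions, so it saves
  at most \<open>4 * 2^m\<close> arcs in total. There are \<open>M^4\<close> walks, hence fewer than about
  \<open>M^4 / 8\<close> shortcuts leave one walk at half of its length. Choosing \<open>M\<close> of order \<open>p^(1/4)\<close> and \<open>2^m\<close> of
  order \<open>n / M^3\<close> gives the bound.
\<close>

section \<open>Bit reversal\<close>

text \<open>Only the low \<open>m\<close> bits of \<open>a\<close> are read, so thresholds of every
  size get a layer and the assignment has period \<open>2 ^ m\<close>.\<close>

fun bit_rev :: "nat \<Rightarrow> nat \<Rightarrow> nat" where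
  "bit_rev 0 a = 0"
| "bit_rev (Suc m) a = (a mod 2) * 2 ^ m + bit_rev m (a div 2)"

lemma bit_rev_less: "bit_rev m a < 2 ^ m"
proof (induction m arbitrary: a)
  case (Suc m)
  have "bit_rev m (a div 2) < 2 ^ m" by (rule Suc.IH)
  moreover have "(a mod 2) * 2 ^ m \<le> 1 * 2 ^ m" by (intro mult_le_mono1) simp
  ultimately have "(a mod 2) * 2 ^ m + bit_rev m (a div 2) < 2 * 2 ^ m" by linarith
  then show ?case by simp
qed simp

text \<open>Fixing the top \<open>m - t\<close> bits of the reversal amounts to fixing the low
  \<open>m - t\<close> bits of \<open>a\<close>, that is, a residue class. In the induction the top
  bit of \<open>b\<close> becomes the parity of \<open>a\<close>.\<close>

lemma bit_rev_dyadic_block: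
  assumes "t \<le> m" "b < 2 ^ (m - t)"
  shows "\<exists>r < 2 ^ (m - t). \<forall>a. a mod 2 ^ (m - t) = r \<longrightarrow> bit_rev m a div 2 ^ t = b"
  using assms
proof (induction m arbitrary: b)
  case 0
  then show ?case by auto
next
  case (Suc m)
  show ?case
  proof (cases "t = Suc m")
    case True
    then show ?thesis using Suc.prems bit_rev_less[of "Suc m"] by auto
  next
    case False
    with Suc.prems have t: "t \<le> m" by simp
    then have split: "(2::nat) ^ (Suc m - t) = 2 * 2 ^ (m - t)" by (simp add: Suc_diff_le)
    define \<beta> where "\<beta> = b div 2 ^ (m - t)"
    define b' where "b' = b mod 2 ^ (m - t)"
    have b: "b = \<beta> * 2 ^ (m - t) + b'" unfolding \<beta>_def b'_def by (rule div_mult_mod_eq[symmetric])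
    have \<beta>: "\<beta> < 2"
      using Suc.prems(2) unfolding \<beta>_def split by (simp add: less_mult_imp_div_less)
    have "b' < 2 ^ (m - t)" by (simp add: b'_def)
    from Suc.IH[OF t this] obtain r where r: "r < 2 ^ (m - t)"
      "\<And>a. a mod 2 ^ (m - t) = r \<Longrightarrow> bit_rev m a div 2 ^ t = b'" by blast
    have "bit_rev (Suc m) a div 2 ^ t = b" if a: "a mod 2 ^ (Suc m - t) = 2 * r + \<beta>" for a
    proof -
      have a': "a mod 2 ^ (Suc m - t) = 2 * (a div 2 mod 2 ^ (m - t)) + a mod 2"
        unfolding split by (rule mod_mult2_eq)
      have unique: "p = \<beta> \<and> q = r" if "2 * q + p = 2 * r + \<beta>" "p < 2" for p q
        using that \<beta> by presburger
      have mod2: "a mod 2 = \<beta>" and div2: "a div 2 mod 2 ^ (m - t) = r"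
        using unique[OF trans[OF a'[symmetric] a]] by simp_all
      have m: "(2::nat) ^ m = 2 ^ (m - t) * 2 ^ t"
        using t by (simp flip: power_add)
      have "bit_rev (Suc m) a = (\<beta> * 2 ^ (m - t)) * 2 ^ t + bit_rev m (a div 2)"
        by (simp add: mod2 m)
      then show ?thesis using r(2)[OF div2] b by simp
    qed
    moreover have "2 * r + \<beta> < 2 ^ (Suc m - t)" using r(1) \<beta> unfolding split by linarith
    ultimately show ?thesis by blast
  qed
qed

text \<open>The interval from \<open>i\<close> to \<open>j\<close> contains an aligned block of
  length \<open>2 ^ t\<close>, more than a quarter of \<open>j - i\<close>. A full residue class
  modulo \<open>k = 2 ^ (m - t)\<close> is mapped into this block, and it meets every
  \<open>k\<close> consecutive integers.\<close>

lemma bit_rev_hits: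
  assumes "i < j" "j \<le> 2 ^ m"
  shows "\<exists>k. k * (j - i) \<le> 4 * 2 ^ m \<and>
    (\<forall>x. \<exists>a. x < a \<and> a \<le> x + k \<and> i \<le> bit_rev m a \<and> bit_rev m a < j)"
proof -
  \<comment> \<open>The added one matters: an aligned block of length \<open>2 ^ t\<close> is sure
    to fit once \<open>2 * 2 ^ t - 1 \<le> j - i\<close>.\<close>
  have "\<exists>t. 2 ^ t \<le> j - i + 1 \<and> j - i + 1 < 2 ^ (t + 1)"
    using ex_power_ivl1[of 2 "j - i + 1"] by auto
  then obtain s where s: "2 ^ s \<le> j - i + 1" "j - i + 1 < 2 ^ (s + 1)" by auto
  have "s \<noteq> 0" using s(2) assms(1) by (cases s) auto
  then obtain t where t: "s = Suc t" by (cases s) auto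
  have len: "2 * 2 ^ t \<le> j - i + 1" "j - i < 4 * 2 ^ t" using s by (simp_all add: t)
  have "t \<le> m"
  proof (rule ccontr)
    assume "\<not> t \<le> m"
    then have "(2::nat) * 2 ^ m \<le> 2 ^ t"
      by (metis not_less_eq_eq one_le_numeral power_Suc power_increasing)
    moreover have "(1::nat) \<le> 2 ^ m" by simp
    ultimately show False using len(1) assms by linarith
  qed
  \<comment> \<open>The index of the first aligned block that starts at or after
    \<open>i\<close>.\<close>
  define b where "b = (i + 2 ^ t - 1) div 2 ^ t"
  have pos: "(0::nat) < 2 ^ t" by simp
  have "b * 2 ^ t \<le> i + 2 ^ t - 1" by (simp add: b_def)
  moreover have "i + 2 ^ t - 1 < b * 2 ^ t + 2 ^ t"
    unfolding b_def using dividend_less_div_times[OF pos] by (simp add: add.commute)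
  ultimately have b: "i \<le> b * 2 ^ t" "b * 2 ^ t + 2 ^ t \<le> j"
    using len(1) assms(1) pos by linarith+
  have m: "(2::nat) ^ m = 2 ^ (m - t) * 2 ^ t" using \<open>t \<le> m\<close> by (simp flip: power_add)
  have "(b + 1) * 2 ^ t \<le> 2 ^ (m - t) * 2 ^ t" using b(2) assms(2) m by simp
  then have "b + 1 \<le> 2 ^ (m - t)" using pos by (metis mult_le_cancel2)
  then have "b < 2 ^ (m - t)" by simp
  from bit_rev_dyadic_block[OF \<open>t \<le> m\<close> this] obtain r where r: "r < 2 ^ (m - t)"
    "\<And>a. a mod 2 ^ (m - t) = r \<Longrightarrow> bit_rev m a div 2 ^ t = b" by blast
  define k :: nat where "k = 2 ^ (m - t)"
  have hit: "i \<le> bit_rev m a \<and> bit_rev m a < j" if "a mod k = r" for a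
  proof -
    have d: "bit_rev m a div 2 ^ t = b" using r(2) that by (simp add: k_def)
    have "bit_rev m a = b * 2 ^ t + bit_rev m a mod 2 ^ t"
      using div_mult_mod_eq[of "bit_rev m a" "2 ^ t"] d by simp
    moreover have "bit_rev m a mod 2 ^ t < 2 ^ t" by simp
    ultimately show ?thesis using b by linarith
  qed
  have "\<exists>a. x < a \<and> a \<le> x + k \<and> a mod k = r" for x
  proof -
    have k: "0 < k" "r < k" using r(1) by (simp_all add: k_def)
    \<comment> \<open>\<open>q * k + r\<close> is the largest member of the residue class that does
      not exceed \<open>x + k\<close>.\<close>
    define q where "q = (x + k - r) div k"
    have "q * k \<le> x + k - r" by (simp add: q_def)
    moreover have "x + k - r < q * k + k"
      unfolding q_def using dividend_less_div_times[OF k(1)] by (simp add: add.commute)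
    ultimately have "x < q * k + r \<and> q * k + r \<le> x + k \<and> (q * k + r) mod k = r"
      using k by auto
    then show ?thesis by blast
  qed
  moreover have "k * (j - i) \<le> 4 * 2 ^ m"
  proof -
    have "k * (j - i) \<le> k * (4 * 2 ^ t)" using len(2) by simp
    then show ?thesis by (simp add: m k_def)
  qed
  ultimately show ?thesis using hit by blast
qed

section \<open>Layered graphs\<close>

text \<open>Triples are packed into \<open>nat\<close> by a bijection, so vertices outside the grid
  have coordinates too.\<close>

definition layer :: "nat \<Rightarrow> nat" where
  "layer v = fst (prod_decode v)"

definition ypos :: "nat \<Rightarrow> nat" where
  "ypos v = fst (prod_decode (snd (prod_decode v)))"

definition zpos :: "nat \<Rightarrow> nat" where
  "zpos v = snd (prod_decode (snd (prod_decode v)))"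

definition vertex :: "nat \<Rightarrow> nat \<Rightarrow> nat \<Rightarrow> nat" where
  "vertex i y z = prod_encode (i, prod_encode (y, z))"

lemma vertex_simps [simp]:
  "layer (vertex i y z) = i" "ypos (vertex i y z) = y" "zpos (vertex i y z) = z"
  by (simp_all add: layer_def ypos_def zpos_def vertex_def)

lemma vertex_collapse [simp]: "vertex (layer v) (ypos v) (zpos v) = v"
  by (simp add: layer_def ypos_def zpos_def vertex_def)

text \<open>\<open>g\<close> is positive for \<open>a \<le> x\<close> and negative beyond, so
  omitting the former or adding the latter lowers the sum. The odd constant keeps \<open>g\<close>
  away from zero, which makes the maximiser unique.\<close>

lemma sum_initial_segment_optimal:
  fixes x x' :: nat and P :: "nat \<Rightarrow> bool"
  defines "A \<equiv> {a. a \<le> x \<and> P a}" and "B \<equiv> {a. a \<le> x' \<and> P a}"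
  defines "g \<equiv> \<lambda>a. 2 * int x + 1 - 2 * int a"
  shows "sum g B \<le> sum g A" and "sum g B = sum g A \<Longrightarrow> A = B"
proof -
  have fin: "finite A" "finite B" by (simp_all add: A_def B_def)
  have A: "sum g A = sum g (A \<inter> B) + sum g (A - B)"
    and B: "sum g B = sum g (A \<inter> B) + sum g (B - A)"
    using sum.Int_Diff[OF fin(1), of g B] sum.Int_Diff[OF fin(2), of g A]
    by (simp_all add: Int_commute)
  have pos: "g a > 0" if "a \<in> A - B" for a using that by (auto simp: A_def g_def)
  have neg: "g a < 0" if "a \<in> B - A" for a using that by (auto simp: A_def B_def g_def)
  have 1: "sum g (A - B) \<ge> 0" "A - B \<noteq> {} \<Longrightarrow> sum g (A - B) > 0"
    using fin pos by (auto intro!: sum_nonneg sum_pos simp: less_imp_le)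
  have 2: "sum g (B - A) \<le> 0" "B - A \<noteq> {} \<Longrightarrow> sum g (B - A) < 0"
    using fin neg sum_strict_mono[of "B - A" g "\<lambda>_. 0"]
    by (auto intro!: sum_nonpos simp: less_imp_le)
  show "sum g B \<le> sum g A" using A B 1(1) 2(1) by linarith
  assume "sum g B = sum g A"
  then have "A - B = {}" "B - A = {}" using A B 1 2 by fastforce+
  then show "A = B" by blast
qed

locale layered_graph =
  fixes M m :: nat
begin

definition step_set :: "nat \<Rightarrow> nat \<Rightarrow> nat set" where
  "step_set x i = {a. a \<le> x \<and> bit_rev m a = i}"

definition prefix_set :: "nat \<Rightarrow> nat \<Rightarrow> nat set" where
  "prefix_set x i = {a. a \<le> x \<and> bit_rev m a < i}"

text \<open>The walks of interest start with \<open>y < M\<close> and \<open>z < M\<^sup>2\<close>.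
  Thresholds below \<open>M\<close> move them by at most \<open>M\<close> and
  \<open>M\<^sup>2\<close> in total, so doubled sides contain them.\<close>

definition grid :: "nat set" where
  "grid = {v. layer v \<le> 2 ^ m \<and> ypos v < 2 * M \<and> zpos v < 2 * M\<^sup>2}"

text \<open>An arc does not record its direction, so a walk may change direction in every
  layer.\<close>

definition grid_arcs :: "(nat \<times> nat) set" where
  "grid_arcs = {(u, v). u \<in> grid \<and> v \<in> grid \<and> layer v = Suc (layer u) \<and>
     (\<exists>x. ypos v = ypos u + card (step_set x (layer u)) \<and>
          zpos v = zpos u + \<Sum>(step_set x (layer u)))}"

text \<open>
  The point of layer 0 from which the walk with direction \<open>x\<close> reaches \<open>v\<close>. It may lie outside
  the grid, hence the integers.
\<close>
definition start :: "nat \<Rightarrow> nat \<Rightarrow> int \<times> int" where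
  "start x v = (int (ypos v) - int (card (prefix_set x (layer v))),
                int (zpos v) - int (\<Sum>(prefix_set x (layer v))))"

text \<open>On the displacement given by the size and the sum of a set of thresholds, this is the
  sum of \<open>2 * x + 1 - 2 * a\<close> over that set.\<close>

definition weight :: "nat \<Rightarrow> int \<times> int \<Rightarrow> int" where
  "weight x s = (2 * int x + 1) * fst s - 2 * snd s"

lemma finite_sets [simp]: "finite (step_set x i)" "finite (prefix_set x i)"
  by (simp_all add: step_set_def prefix_set_def)

lemma prefix_set_Suc:
  "card (prefix_set x (Suc i)) = card (prefix_set x i) + card (step_set x i)"
  "\<Sum>(prefix_set x (Suc i)) = \<Sum>(prefix_set x i) + \<Sum>(step_set x i)"
proof -
  have "prefix_set x (Suc i) = prefix_set x i \<union> step_set x i"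
    "prefix_set x i \<inter> step_set x i = {}"
    by (auto simp: prefix_set_def step_set_def)
  then show "card (prefix_set x (Suc i)) = card (prefix_set x i) + card (step_set x i)"
    "\<Sum>(prefix_set x (Suc i)) = \<Sum>(prefix_set x i) + \<Sum>(step_set x i)"
    by (simp_all add: card_Un_disjoint sum.union_disjoint)
qed

lemma grid_eq: "grid = (\<lambda>(i, y, z). vertex i y z) ` ({..2 ^ m} \<times> {..<2 * M} \<times> {..<2 * M\<^sup>2})"
proof -
  have "v \<in> (\<lambda>(i, y, z). vertex i y z) ` ({..2 ^ m} \<times> {..<2 * M} \<times> {..<2 * M\<^sup>2})"
    if "v \<in> grid" for v
    using that by (intro image_eqI[of _ _ "(layer v, ypos v, zpos v)"]) (auto simp: grid_def)
  then show ?thesis by (auto simp: grid_def)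
qed

lemma finite_grid [simp]: "finite grid"
  by (simp add: grid_eq)

lemma card_grid: "card grid \<le> 8 * 2 ^ m * M ^ 3"
proof -
  have "card grid \<le> card ({..2 ^ m} \<times> {..<2 * M} \<times> {..<2 * M\<^sup>2} :: (nat \<times> nat \<times> nat) set)"
    unfolding grid_eq by (rule card_image_le) simp
  also have "\<dots> = (2 ^ m + 1) * (4 * M ^ 3)"
    by (simp add: card_cartesian_product power2_eq_square power3_eq_cube)
  also have "\<dots> \<le> (2 * 2 ^ m) * (4 * M ^ 3)" by (intro mult_le_mono1) simp
  finally show ?thesis by simp
qed

section \<open>Monotonicity of the weight and rigidity of starts\<close>

text \<open>Tracing back along \<open>x\<close> subtracts the move of \<open>x\<close>, so the loss
  of weight on an arc made by \<open>x'\<close> is the optimality gap between the two step sets. A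
  zero gap makes the sets equal, and then the start does not move.\<close>

lemma weight_grid_arc:
  assumes "(u, v) \<in> grid_arcs"
  shows "weight x (start x v) \<le> weight x (start x u)"
    and "weight x (start x v) = weight x (start x u) \<Longrightarrow> start x v = start x u"
proof -
  let ?i = "layer u"
  let ?g = "\<lambda>a. 2 * int x + 1 - 2 * int a"
  from assms obtain x' where lay: "layer v = Suc ?i"
    and x': "ypos v = ypos u + card (step_set x' ?i)" "zpos v = zpos u + \<Sum>(step_set x' ?i)"
    unfolding grid_arcs_def by blast
  have sum_g: "sum ?g (step_set w ?i)
      = (2 * int x + 1) * int (card (step_set w ?i)) - 2 * int (\<Sum>(step_set w ?i))" for w
    by (simp add: sum_subtractf sum_distrib_left of_nat_sum mult.commute)
  have diff: "weight x (start x u) - weight x (start x v)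
      = sum ?g (step_set x ?i) - sum ?g (step_set x' ?i)"
    unfolding sum_g weight_def start_def by (simp add: lay prefix_set_Suc x' algebra_simps)
  show "weight x (start x v) \<le> weight x (start x u)"
    using sum_initial_segment_optimal(1)[where x = x and x' = x' and P = "\<lambda>a. bit_rev m a = ?i"] diff
    by (simp add: step_set_def)
  assume "weight x (start x v) = weight x (start x u)"
  then have "step_set x ?i = step_set x' ?i"
    using sum_initial_segment_optimal(2)[where x = x and x' = x' and P = "\<lambda>a. bit_rev m a = ?i"] diff
    by (simp add: step_set_def)
  then show "start x v = start x u"
    by (simp add: start_def lay prefix_set_Suc x')
qed

text \<open>A common start forces the number of thresholds up to \<open>x\<close> in layers
  \<open>i\<close> to \<open>j - 1\<close> to be \<open>ypos v - ypos u\<close>, whatever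
  \<open>x\<close> is. Two such directions at distance \<open>k\<close> or more would have a further
  threshold between them, so all of them lie in a window of length \<open>k\<close>.\<close>

lemma start_constant_card:
  assumes "i < j" "j \<le> 2 ^ m" "layer u = i" "layer v = j"
  shows "card {x. x < M \<and> start x u = start x v} * (j - i) \<le> 4 * 2 ^ m"
proof -
  let ?T = "{x. x < M \<and> start x u = start x v}"
  define hits where "hits x = {a. a \<le> x \<and> i \<le> bit_rev m a \<and> bit_rev m a < j}" for x
  have fin: "finite (hits x)" for x by (simp add: hits_def)
  have card_hits: "int (card (hits x)) = int (ypos v) - int (ypos u)" if "x \<in> ?T" for x
  proof -
    have "prefix_set x j = prefix_set x i \<union> hits x" "prefix_set x i \<inter> hits x = {}"
      using assms(1) by (auto simp: prefix_set_def hits_def)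
    then have "card (prefix_set x j) = card (prefix_set x i) + card (hits x)"
      using fin by (simp add: card_Un_disjoint)
    then show ?thesis using that assms(3,4) by (simp add: start_def)
  qed
  obtain k where k: "k * (j - i) \<le> 4 * 2 ^ m"
    "\<And>x. \<exists>a. x < a \<and> a \<le> x + k \<and> i \<le> bit_rev m a \<and> bit_rev m a < j"
    using bit_rev_hits[OF assms(1,2)] by blast
  have close: "y < x + k" if "x \<in> ?T" "y \<in> ?T" for x y
  proof (rule ccontr)
    assume "\<not> y < x + k"
    moreover obtain a where a: "x < a" "a \<le> x + k" "i \<le> bit_rev m a" "bit_rev m a < j"
      using k(2) by blast
    ultimately have "hits x \<subseteq> hits y" "a \<in> hits y" "a \<notin> hits x" by (auto simp: hits_def)
    then have "hits x \<subset> hits y" by blast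
    then have "card (hits x) < card (hits y)" using fin by (rule psubset_card_mono[rotated])
    then show False using card_hits[OF that(1)] card_hits[OF that(2)] by linarith
  qed
  have "card ?T \<le> k"
  proof (cases "?T = {}")
    case False
    define x0 where "x0 = Min ?T"
    have "x0 \<in> ?T" unfolding x0_def using False by (intro Min_in) auto
    have "?T \<subseteq> {x0..<x0 + k}"
      using close[OF \<open>x0 \<in> ?T\<close>] Min_le[of ?T] by (auto simp: x0_def)
    then have "card ?T \<le> card {x0..<x0 + k}" by (intro card_mono) auto
    then show ?thesis by simp
  qed (simp only: card.empty le0)
  then have "card ?T * (j - i) \<le> k * (j - i)" by (rule mult_le_mono1)
  then show ?thesis using k(1) by linarith
qed

section \<open>Reachability in the padded graph\<close>

text \<open>The vertices of \<open>W\<close> outside the grid are isolated; they adjust the number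
  of vertices to exactly \<open>n\<close>.\<close>

definition graph :: "nat set \<Rightarrow> nat pair_pre_digraph" where
  "graph W = \<lparr>pverts = W, parcs = grid_arcs\<rparr>"

lemma graph_simps [simp]: "pverts (graph W) = W" "parcs (graph W) = grid_arcs"
  by (simp_all add: graph_def)

lemma pair_digraph_graph:
  assumes "finite W" "grid \<subseteq> W"
  shows "pair_digraph (graph W)"
proof
  have "grid_arcs \<subseteq> grid \<times> grid" by (auto simp: grid_arcs_def)
  then show "finite (parcs (graph W))" by (auto intro: finite_subset)
qed (use assms in \<open>auto simp: grid_arcs_def\<close>)

text \<open>The weight never increases along arcs, so equality at the ends forces equality on every
  arc. The layer bound is claimed for distinct ends only, as a padding vertex may decode to any
  layer.\<close>

lemma reachable_graph:
  assumes "u \<rightarrow>\<^sup>*\<^bsub>with_proj (graph W)\<^esub> v"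
  shows "u = v \<or> layer u < layer v \<and> layer v \<le> 2 ^ m"
    and "weight x (start x v) \<le> weight x (start x u)"
    and "weight x (start x v) = weight x (start x u) \<Longrightarrow> start x v = start x u"
proof -
  have "(u = v \<or> layer u < layer v \<and> layer v \<le> 2 ^ m) \<and>
    weight x (start x v) \<le> weight x (start x u) \<and>
    (weight x (start x v) = weight x (start x u) \<longrightarrow> start x v = start x u)"
    using assms unfolding reachable_def
  proof (induction rule: rtrancl_on_induct)
    case base
    then show ?case by simp
  next
    case (step y z)
    then have arc: "(y, z) \<in> grid_arcs" by simp
    then have "layer z = Suc (layer y)" "layer z \<le> 2 ^ m"
      by (auto simp: grid_arcs_def grid_def)
    moreover note weight_grid_arc[OF arc, of x]
    ultimately show ?case using step.IH by auto
  qed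
  then show "u = v \<or> layer u < layer v \<and> layer v \<le> 2 ^ m"
    "weight x (start x v) \<le> weight x (start x u)"
    "weight x (start x v) = weight x (start x u) \<Longrightarrow> start x v = start x u"
    by blast+
qed

lemma reachable_direction:
  assumes "grid \<subseteq> W" "x < M" "y < M" "z < M\<^sup>2" "i \<le> 2 ^ m"
  shows "vertex 0 y z \<rightarrow>\<^sup>*\<^bsub>with_proj (graph W)\<^esub>
    vertex i (y + card (prefix_set x i)) (z + \<Sum>(prefix_set x i))"
proof -
  define w where "w i = vertex i (y + card (prefix_set x i)) (z + \<Sum>(prefix_set x i))" for i
  have w: "w i \<in> grid" if "i \<le> 2 ^ m" for i
  proof -
    have sub: "prefix_set x i \<subseteq> {..<M}" using assms(2) by (auto simp: prefix_set_def)
    have "card (prefix_set x i) \<le> M" using card_mono[OF _ sub] by simp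
    moreover have "\<Sum>(prefix_set x i) \<le> \<Sum>{..<M}" using sub by (intro sum_mono2) auto
    moreover have "\<Sum>{..<M} \<le> M\<^sup>2"
      using sum_bounded_above[of "{..<M}" "\<lambda>a. a" M] by (simp add: power2_eq_square)
    ultimately show ?thesis using assms(3,4) that by (simp add: w_def grid_def)
  qed
  have "w 0 \<rightarrow>\<^sup>*\<^bsub>with_proj (graph W)\<^esub> w i"
    using assms(5)
  proof (induction i)
    case 0
    then show ?case using w[of 0] assms(1) by (auto simp: reachable_def)
  next
    case (Suc i)
    have "(w i, w (Suc i)) \<in> grid_arcs"
      using w[of i] w[of "Suc i"] Suc.prems unfolding grid_arcs_def
      by (auto simp: w_def prefix_set_Suc)
    moreover have "w (Suc i) \<in> W" using w Suc.prems assms(1) by blast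
    moreover have "w 0 \<rightarrow>\<^sup>*\<^bsub>with_proj (graph W)\<^esub> w i" using Suc by simp
    ultimately show ?case
      unfolding reachable_def by (auto intro: rtrancl_on_into_rtrancl_on)
  qed
  moreover have "w 0 = vertex 0 y z" by (simp add: w_def prefix_set_def)
  ultimately show ?thesis by (simp add: w_def)
qed

section \<open>Total savings of a shortcut set\<close>

text \<open>The layers spanned by all shortcuts with both ends on the line of direction
  \<open>x\<close> through \<open>s\<close>. The subtraction does not truncate, since shortcuts
  ascend.\<close>

definition cost :: "nat \<Rightarrow> int \<times> int \<Rightarrow> (nat \<times> nat) set \<Rightarrow> nat" where
  "cost x s H = (\<Sum>e\<in>{e \<in> H. start x (fst e) = s \<and> start x (snd e) = s}.
     layer (snd e) - layer (fst e))"

context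
  fixes W :: "nat set" and H :: "(nat \<times> nat) set"
  assumes W: "finite W" "grid \<subseteq> W"
    and H: "shortcut_set (graph W) H"
begin

lemma finite_shortcuts: "finite H"
  using pair_digraph.pair_digraph_add_shortcuts(2)[OF pair_digraph_graph[OF W] H] .

lemma shortcut_layer:
  assumes "(u, v) \<in> H"
  shows "layer u < layer v" "layer v \<le> 2 ^ m"
  using assms H reachable_graph(1)[where u = u and v = v] by (auto simp: shortcut_set_def)

lemma weight_arc:
  assumes "(u, v) \<in> grid_arcs \<union> H"
  shows "weight x (start x v) \<le> weight x (start x u)"
    and "weight x (start x v) = weight x (start x u) \<Longrightarrow> start x v = start x u"
proof -
  have "(u, v) \<in> grid_arcs \<or> u \<rightarrow>\<^sup>*\<^bsub>with_proj (graph W)\<^esub> v"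
    using assms H by (auto simp: shortcut_set_def)
  then show "weight x (start x v) \<le> weight x (start x u)"
    "weight x (start x v) = weight x (start x u) \<Longrightarrow> start x v = start x u"
    using weight_grid_arc reachable_graph(2,3) by blast+
qed

lemma weight_walk:
  assumes "pcas u p v" "set p \<subseteq> grid_arcs \<union> H"
  shows "weight x (start x v) \<le> weight x (start x u)"
  using assms
proof (induction p arbitrary: u)
  case (Cons e p)
  obtain w where e: "e = (u, w)" using Cons.prems by (cases e) auto
  then have "weight x (start x v) \<le> weight x (start x w)" using Cons by simp
  also have "\<dots> \<le> weight x (start x u)" using Cons.prems by (intro weight_arc(1)) (simp add: e)
  finally show ?case .
qed simp

text \<open>Each arc climbs one layer, paid by the length, or is a shortcut, paid by the sum.
  Restricting the sum to shortcuts from \<open>layer u\<close> upwards ensures that the first arc is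
  not charged again in the rest of the walk.\<close>

lemma layer_walk_aux:
  assumes "pcas u p v" "set p \<subseteq> grid_arcs \<union> H" "start x u = s" "start x v = s"
  shows "layer v \<le> layer u + length p +
    (\<Sum>e\<in>{e \<in> H. layer u \<le> layer (fst e) \<and> start x (fst e) = s \<and> start x (snd e) = s}.
       layer (snd e) - layer (fst e))"
  using assms
proof (induction p arbitrary: u)
  case (Cons e p)
  define S where "S u = {e \<in> H. layer u \<le> layer (fst e) \<and>
    start x (fst e) = s \<and> start x (snd e) = s}" for u
  let ?f = "\<lambda>e. layer (snd e) - layer (fst e)"
  have fin: "finite (S u)" for u using finite_shortcuts by (simp add: S_def)
  obtain w where e: "e = (u, w)" using Cons.prems by (cases e) auto
  then have arc: "(u, w) \<in> grid_arcs \<union> H" and p: "pcas w p v" "set p \<subseteq> grid_arcs \<union> H"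
    using Cons.prems by auto
  \<comment> \<open>The weight at \<open>w\<close> is squeezed between the equal weights at
    \<open>v\<close> and \<open>u\<close>; hence the walk cannot leave the line.\<close>
  have "weight x (start x w) = weight x (start x u)"
    using weight_walk[OF p, of x] weight_arc(1)[OF arc, of x] Cons.prems(3,4) by simp
  then have start: "start x w = s" using weight_arc(2)[OF arc] Cons.prems(3) by metis
  have IH: "layer v \<le> layer w + length p + sum ?f (S w)"
    using Cons.IH[OF p start Cons.prems(4)] by (simp add: S_def)
  have "layer w + sum ?f (S w) \<le> layer u + 1 + sum ?f (S u)"
  proof (cases "(u, w) \<in> H")
    case True
    then have less: "layer u < layer w" using shortcut_layer by blast
    have "insert (u, w) (S w) \<subseteq> S u"
      using True less start Cons.prems(3) by (auto simp: S_def)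
    then have "sum ?f (insert (u, w) (S w)) \<le> sum ?f (S u)"
      by (intro sum_mono2 fin) auto
    moreover have "(u, w) \<notin> S w" using less by (simp add: S_def)
    ultimately show ?thesis using fin less by simp
  next
    case False
    then have "layer w = layer u + 1" using arc by (simp add: grid_arcs_def)
    moreover from this have "sum ?f (S w) \<le> sum ?f (S u)"
      by (intro sum_mono2 fin) (auto simp: S_def)
    ultimately show ?thesis by simp
  qed
  with IH show ?case by (simp add: S_def)
qed simp

lemma layer_walk:
  assumes "pcas u p v" "set p \<subseteq> grid_arcs \<union> H" "start x u = s" "start x v = s"
  shows "layer v \<le> layer u + length p + cost x s H"
proof -
  have "(\<Sum>e\<in>{e \<in> H. layer u \<le> layer (fst e) \<and> start x (fst e) = s \<and> start x (snd e) = s}.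
      layer (snd e) - layer (fst e)) \<le> cost x s H"
    unfolding cost_def using finite_shortcuts by (intro sum_mono2) auto
  then show ?thesis using layer_walk_aux[OF assms] by linarith
qed

text \<open>Double counting: for a given \<open>x\<close> a shortcut counts for at most one
  \<open>s\<close>, the common start of its ends, and the number of such \<open>x\<close> times its
  span is at most \<open>4 * 2 ^ m\<close>.\<close>

lemma sum_cost_le:
  assumes "finite S"
  shows "(\<Sum>x<M. \<Sum>s\<in>S. cost x s H) \<le> card H * (4 * 2 ^ m)"
proof -
  let ?f = "\<lambda>e. layer (snd e) - layer (fst e)"
  have inner: "(\<Sum>s\<in>S. if start x (fst e) = s \<and> start x (snd e) = s then ?f e else 0)
      \<le> (if start x (fst e) = start x (snd e) then ?f e else 0)" for x e
  proof -
    have "(\<Sum>s\<in>S. if start x (fst e) = s \<and> start x (snd e) = s then ?f e else 0)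
      = (\<Sum>s\<in>S. if start x (fst e) = s then
           (if start x (fst e) = start x (snd e) then ?f e else 0) else 0)"
      by (intro sum.cong) auto
    then show ?thesis using assms by (simp add: sum.delta')
  qed
  have "(\<Sum>x<M. \<Sum>s\<in>S. cost x s H)
      = (\<Sum>x<M. \<Sum>s\<in>S. \<Sum>e\<in>H. if start x (fst e) = s \<and> start x (snd e) = s then ?f e else 0)"
    unfolding cost_def using finite_shortcuts by (simp add: sum.inter_filter)
  also have "\<dots> = (\<Sum>x<M. \<Sum>e\<in>H. \<Sum>s\<in>S.
      if start x (fst e) = s \<and> start x (snd e) = s then ?f e else 0)"
    by (intro sum.cong refl sum.swap)
  also have "\<dots> \<le> (\<Sum>x<M. \<Sum>e\<in>H. if start x (fst e) = start x (snd e) then ?f e else 0)"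
    by (intro sum_mono inner)
  also have "\<dots> = (\<Sum>e\<in>H. \<Sum>x<M. if start x (fst e) = start x (snd e) then ?f e else 0)"
    by (rule sum.swap)
  also have "\<dots> \<le> (\<Sum>e\<in>H. 4 * 2 ^ m)"
  proof (rule sum_mono)
    fix e assume "e \<in> H"
    then have "layer (fst e) < layer (snd e)" "layer (snd e) \<le> 2 ^ m"
      using shortcut_layer[of "fst e" "snd e"] by auto
    then have "card {x. x < M \<and> start x (fst e) = start x (snd e)} * ?f e \<le> 4 * 2 ^ m"
      by (rule start_constant_card) simp_all
    moreover have "(\<Sum>x<M. if start x (fst e) = start x (snd e) then ?f e else 0)
        = card {x. x < M \<and> start x (fst e) = start x (snd e)} * ?f e"
      by (simp flip: sum.inter_filter add: lessThan_def)
    ultimately show "(\<Sum>x<M. if start x (fst e) = start x (snd e) then ?f e else 0) \<le> 4 * 2 ^ m"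
      by simp
  qed
  finally show ?thesis by simp
qed

text \<open>Averaging over the \<open>M ^ 4\<close> choices of direction and start: were every cost
  above \<open>2 ^ m / 2\<close>, twice the total would be at least
  \<open>M ^ 4 * (2 ^ m + 1)\<close>, against the bound \<open>8 * card H * 2 ^ m\<close>.\<close>

lemma exists_cheap_direction:
  assumes "M > 0" "8 * card H \<le> M ^ 4"
  shows "\<exists>x<M. \<exists>y<M. \<exists>z<M\<^sup>2. 2 * cost x (int y, int z) H \<le> 2 ^ m"
proof (rule ccontr)
  assume "\<not> ?thesis"
  then have large: "2 ^ m + 1 \<le> 2 * cost x (int y, int z) H" if "x < M" "y < M" "z < M\<^sup>2" for x y z
    using that not_le[of "2 * cost x (int y, int z) H" "2 ^ m"] by fastforce
  define S where "S = {0..<int M} \<times> {0..<int (M\<^sup>2)}"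
  have large': "2 ^ m + 1 \<le> 2 * cost x s H" if "x < M" "s \<in> S" for x s
    using large[of x "nat (fst s)" "nat (snd s)"] that unfolding S_def
    by (cases s) (auto simp: nat_less_iff)
  have "card S = M ^ 3" by (simp add: S_def card_cartesian_product power2_eq_square power3_eq_cube flip: of_nat_mult)
  then have "M ^ 4 * (2 ^ m + 1) = (\<Sum>x<M. \<Sum>s\<in>S. 2 ^ m + 1)"
    by (simp add: power4_eq_xxxx power3_eq_cube algebra_simps)
  also have "\<dots> \<le> (\<Sum>x<M. \<Sum>s\<in>S. 2 * cost x s H)"
    by (intro sum_mono large') auto
  also have "\<dots> = 2 * (\<Sum>x<M. \<Sum>s\<in>S. cost x s H)" by (simp add: sum_distrib_left)
  also have "\<dots> \<le> 2 * (card H * (4 * 2 ^ m))"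
    using sum_cost_le[of S] by (simp add: S_def)
  also have "\<dots> = 8 * card H * 2 ^ m" by simp
  also have "\<dots> \<le> M ^ 4 * 2 ^ m" using assms(2) by (rule mult_le_mono1)
  finally show False using assms(1) by simp
qed

end

end

section \<open>From walk lengths to the diameter\<close>

lemma diameter_add_shortcuts_ge:
  fixes r :: real
  assumes G: "pair_digraph G" and H: "shortcut_set G H"
    and reach: "s \<rightarrow>\<^sup>*\<^bsub>with_proj G\<^esub> t"
    and walk: "\<And>p. pcas s p t \<Longrightarrow> set p \<subseteq> parcs G \<union> H \<Longrightarrow> r \<le> real (length p)"
  shows "ereal r \<le> diameter (add_shortcuts G H)"
proof -
  interpret GH: pair_digraph "add_shortcuts G H"
    using pair_digraph.pair_digraph_add_shortcuts(1)[OF G H] .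
  have parcs: "parcs (add_shortcuts G H) = parcs G \<union> H" by (simp add: add_shortcuts_def)
  let ?D = "{unweighted_dist (add_shortcuts G H) u v | u v.
    u \<rightarrow>\<^sup>*\<^bsub>with_proj (add_shortcuts G H)\<^esub> v}"
  \<comment> \<open>\<open>Max\<close> bounds the members of a set only if the set is
    finite.\<close>
  have "?D \<subseteq> (\<lambda>(u, v). unweighted_dist (add_shortcuts G H) u v) `
      (pverts (add_shortcuts G H) \<times> pverts (add_shortcuts G H))"
    using GH.reachable_in_verts by fastforce
  then have fin: "finite ?D"
    by (rule finite_subset) (simp add: GH.pair_finite_verts)
  have "s \<rightarrow>\<^sup>*\<^bsub>with_proj (add_shortcuts G H)\<^esub> t"
    using reach unfolding reachable_def
    by (rule rtrancl_on_mono[rotated 2]) (auto simp: add_shortcuts_def)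
  then have "unweighted_dist (add_shortcuts G H) s t \<in> ?D" by blast
  then have "unweighted_dist (add_shortcuts G H) s t \<le> diameter (add_shortcuts G H)"
    unfolding diameter_def by (rule Max_ge[OF fin])
  moreover have "ereal r \<le> unweighted_dist (add_shortcuts G H) s t"
    unfolding GH.unweighted_dist_conv
  proof (rule INF_greatest)
    fix p assume "p \<in> {p. GH.awalk s p t}"
    then have "pcas s p t" "set p \<subseteq> parcs G \<union> H"
      by (auto simp: GH.awalk_def parcs)
    then show "ereal r \<le> ereal (real (length p))" using walk by simp
  qed
  ultimately show ?thesis by (rule order_trans[rotated])
qed

lemma exists_superset_card:
  fixes A :: "nat set"
  assumes "finite A" "card A \<le> n"
  shows "\<exists>B. finite B \<and> A \<subseteq> B \<and> card B = n"
proof -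
  have "infinite (- A)" using assms(1) by simp
  then obtain C where C: "finite C" "card C = n - card A" "C \<subseteq> - A"
    using infinite_arbitrarily_large by blast
  then have "card (A \<union> C) = n" using assms by (subst card_Un_disjoint) auto
  then show ?thesis using assms(1) C(1) by (intro exI[of _ "A \<union> C"]) auto
qed

lemma exists_graph_large_diameter:
  fixes M m n :: nat
  assumes "M > 0" "8 * 2 ^ m * M ^ 3 \<le> n"
  shows "\<exists>G :: nat pair_pre_digraph. pair_digraph G \<and> card (pverts G) = n \<and>
    (\<forall>H. shortcut_set G H \<and> 8 * card H \<le> M ^ 4 \<longrightarrow>
      ereal (2 ^ m / 2) \<le> diameter (add_shortcuts G H))"
proof -
  interpret layered_graph M m .
  obtain W where W: "finite W" "grid \<subseteq> W" "card W = n"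
    using exists_superset_card[OF finite_grid, of n] card_grid assms(2) by auto
  have "ereal (2 ^ m / 2) \<le> diameter (add_shortcuts (graph W) H)"
    if H: "shortcut_set (graph W) H" and card_H: "8 * card H \<le> M ^ 4" for H
  proof -
    obtain x y z where xyz: "x < M" "y < M" "z < M\<^sup>2" "2 * cost x (int y, int z) H \<le> 2 ^ m"
      using exists_cheap_direction[OF W(1,2) H assms(1) card_H] by blast
    show ?thesis
    proof (rule diameter_add_shortcuts_ge[OF pair_digraph_graph[OF W(1,2)] H
          reachable_direction[OF W(2) xyz(1-3) order_refl]])
      fix p
      assume p: "pcas (vertex 0 y z) p (vertex (2 ^ m) (y + card (prefix_set x (2 ^ m)))
          (z + \<Sum>(prefix_set x (2 ^ m))))"
        and "set p \<subseteq> parcs (graph W) \<union> H"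
      then have "set p \<subseteq> grid_arcs \<union> H" by simp
      \<comment> \<open>Both ends have start \<open>(y, z)\<close>: the prefix set of layer 0 is
        empty, and the displacement at the top is exactly that of \<open>x\<close>.\<close>
      from layer_walk[OF W(1,2) H p this, of x "(int y, int z)"]
      have "2 ^ m \<le> length p + cost x (int y, int z) H"
        by (simp add: start_def prefix_set_def)
      then have "2 ^ m \<le> 2 * length p" using xyz(4) by linarith
      then have "real (2 ^ m) \<le> real (2 * length p)" by (rule of_nat_mono)
      then show "2 ^ m / 2 \<le> real (length p)" by simp
    qed
  qed
  then show ?thesis using pair_digraph_graph[OF W(1,2)] W(3)
    by (intro exI[of _ "graph W"]) simp
qed

text \<open>A single arc suffices when \<open>p\<close> is so large that the grid does not fit into
  \<open>n\<close> vertices, because the required bound is then at most 1.\<close>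

lemma exists_graph_diameter_ge_1:
  assumes "n \<ge> 2"
  shows "\<exists>G :: nat pair_pre_digraph. pair_digraph G \<and> card (pverts G) = n \<and>
    (\<forall>H. shortcut_set G H \<longrightarrow> 1 \<le> diameter (add_shortcuts G H))"
proof -
  define G :: "nat pair_pre_digraph" where "G = \<lparr>pverts = {..<n}, parcs = {(0, 1)}\<rparr>"
  have G: "pair_digraph G" by standard (use assms in \<open>auto simp: G_def\<close>)
  have "0 \<rightarrow>\<^sup>*\<^bsub>with_proj G\<^esub> 1"
    using assms unfolding reachable_def
    by (auto simp: G_def intro: rtrancl_on_into_rtrancl_on[of 0 0])
  moreover have "1 \<le> real (length p)" if "pcas 0 p (1::nat)" for p
    using that by (cases p) auto
  ultimately have "ereal 1 \<le> diameter (add_shortcuts G H)" if "shortcut_set G H" for H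
    using diameter_add_shortcuts_ge[OF G that] by blast
  then show ?thesis using G by (intro exI[of _ G]) (simp add: G_def one_ereal_def)
qed

section \<open>Choice of parameters\<close>

lemma exists_graph_tradeoff:
  fixes p :: real
  assumes "n \<ge> 2" "p \<ge> 1"
  shows "\<exists>G :: nat pair_pre_digraph. pair_digraph G \<and> card (pverts G) = n \<and>
    (\<forall>H. shortcut_set G H \<and> real (card H) \<le> p \<longrightarrow>
      ereal (1 / 864 * (real n / p powr (3/4))) \<le> diameter (add_shortcuts G H))"
proof -
  define q where "q = p powr (1/4)"
  have q: "q \<ge> 1" using assms(2) by (simp add: q_def ge_one_powr_ge_zero)
  have q4: "q ^ 4 = p" and q3: "q ^ 3 = p powr (3/4)"
    using assms(2) by (simp_all add: q_def powr_power)
  \<comment> \<open>The factor 2 gives \<open>M ^ 4 \<ge> 16 * p\<close>, enough for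
    \<open>8 * card H \<le> M ^ 4\<close>. Rounding up costs at most \<open>q\<close>, as
    \<open>q \<ge> 1\<close>.\<close>
  define M where "M = nat \<lceil>2 * q\<rceil>"
  have M: "2 * q \<le> real M" "real M \<le> 3 * q"
    using q by (auto simp: M_def) linarith+
  then have "M > 0" using q by (cases "M = 0") auto
  have M3: "real M ^ 3 \<le> 27 * q ^ 3"
    using power_mono[OF M(2), of 3] by (simp add: power_mult_distrib)
  have M4: "8 * k \<le> M ^ 4" if "real k \<le> p" for k
  proof -
    have "real (8 * k) \<le> 16 * q ^ 4" using that q4 assms(2) by simp
    also have "\<dots> \<le> real M ^ 4" using power_mono[OF M(1), of 4] q by (simp add: power_mult_distrib)
    finally show ?thesis by (metis of_nat_le_iff of_nat_power)
  qed
  \<comment> \<open>Here \<open>864 = 32 * 27\<close>: 27 comes from \<open>M \<le> 3 * q\<close>,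
    and 32 from \<open>n \<le> 2 ^ (m + 1) * 8 * M ^ 3\<close> with
    \<open>r = 2 ^ m / 2\<close>.\<close>
  have bound: "1 / 864 * (real n / p powr (3/4)) \<le> r" if "real n \<le> 32 * r * real M ^ 3" "r \<ge> 0" for r
  proof -
    have "real n \<le> 32 * r * (27 * q ^ 3)"
      using that M3 by (meson mult_left_mono order_trans mult_nonneg_nonneg zero_le_numeral)
    moreover have "q ^ 3 > 0" using q by simp
    ultimately show ?thesis unfolding q3[symmetric] by (simp add: field_simps)
  qed
  show ?thesis
  proof (cases "n < 8 * M ^ 3")
    case True
    then have "real n \<le> real (8 * M ^ 3)" by (simp only: of_nat_le_iff)
    then have "real n \<le> 32 * 1 * real M ^ 3" by simp
    then have "ereal (1 / 864 * (real n / p powr (3/4))) \<le> 1"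
      using bound[of 1] by (simp add: one_ereal_def)
    then show ?thesis
      using exists_graph_diameter_ge_1[OF assms(1)] order_trans by blast
  next
    case False
    define L where "L = n div (8 * M ^ 3)"
    have "8 * M ^ 3 > 0" using \<open>M > 0\<close> by simp
    then have "L \<ge> 1" using False by (simp add: L_def div_greater_zero_iff Suc_le_eq)
    then obtain m where m: "2 ^ m \<le> L" "L < 2 ^ (m + 1)"
      using ex_power_ivl1[of 2 L] by auto
    have "8 * 2 ^ m * M ^ 3 \<le> L * (8 * M ^ 3)" using m(1) by simp
    also have "\<dots> \<le> n" by (simp add: L_def)
    finally have le: "8 * 2 ^ m * M ^ 3 \<le> n" .
    have "n < (L + 1) * (8 * M ^ 3)"
      unfolding L_def using dividend_less_times_div[OF \<open>8 * M ^ 3 > 0\<close>, of n]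
      by (simp add: algebra_simps)
    also have "\<dots> \<le> 2 ^ (m + 1) * (8 * M ^ 3)" using m(2) by (intro mult_le_mono1) simp
    finally have "real n \<le> real (2 ^ (m + 1) * (8 * M ^ 3))" by (simp only: of_nat_le_iff)
    then have "1 / 864 * (real n / p powr (3/4)) \<le> 2 ^ m / 2"
      by (intro bound) simp_all
    then have "ereal (1 / 864 * (real n / p powr (3/4))) \<le> ereal (2 ^ m / 2)" by simp
    then show ?thesis
      using exists_graph_large_diameter[OF \<open>M > 0\<close> le] M4 order_trans by blast
  qed
qed

theorem theorem1p2:
  shows "\<exists>c::real. c > 0 \<and>
    infinite {n::nat. n > 0 \<and>
      (\<forall>p::real. 1 \<le> p \<and> p \<le> real n powr (4/3) \<longrightarrow>
        (\<exists>G :: nat pair_pre_digraph. pair_digraph G \<and> card (pverts G) = n \<and>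
          (\<forall>H. shortcut_set G H \<and> real (card H) \<le> p \<longrightarrow>
            ereal (c * (real n / p powr (3/4))) \<le> diameter (add_shortcuts G H))))}"
    (is "\<exists>c. c > 0 \<and> infinite (?S c)")
proof (intro exI conjI)
  \<comment> \<open>Only \<open>n = 1\<close> is left out, where the diameter is 0.\<close>
  have "{2..} \<subseteq> ?S (1 / 864)" using exists_graph_tradeoff by auto
  then show "infinite (?S (1 / 864))" using infinite_Ici infinite_super by blast
qed simp

end
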